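(* Let $x$ and $y$ be eventually periodic bi-infinite sequences over a finite alphabet $\mathcal A$, and let $X$ and $Y$ be the subshifts generated by $x$ and $y$ respectively. Then $X$ and $Y$ are conjugate if and only if $x$ and $y$ have the same least period $N$ and their anomaly sizes satisfy $a(x)\equiv a(y) \pmod N$.
   Context: $\mathcal A$ is a finite set and $\mathcal A^{\mathbb Z}$ is the space of bi-infinite sequences $x=(x_i)_{i\in\mathbb Z}$ with the product topology (of the discrete topology on $\mathcal A$); the shift is $\sigma(x)_i=x_{i+1}$. For integers $i\le j$, $x_{[i,j]}$ denotes the word $x_ix_{i+1}\cdots x_j$; $|w|$ is the length of a word $w$. A sequence $x$ is periodic if $\sigma^N(x)=x$ for some integer $N>0$; the least such $N$ is its least period. A non-periodic $x\in\mathcal A^{\mathbb Z}$ is eventually periodic if there are integers $i$ and $n>0$ such that, removing the word $v=x_{[i+1,i+n]}$ occurring at that position, the resulting sequence $p_v(x)$ defined by $p_v(x)_k=x_k$ for $k\le i$ and $p_v(x)_k=x_{k+n}$ for $k>i$ is periodic. Such a word $v$ (together with its position) is called an anomaly word, or anomaly, for $x$. The least period of $x$ is the least period of the periodic sequence $p_v(x)$; this does not depend on the choice of the anomaly word $v$. The anomaly size of $x$ is $a(x)=\min\{|u| : u \text{ is an anomaly word for } x\}$. The subshift generated by $x$ is the closure of the orbit $\{\sigma^k(x):k\in\mathbb Z\}$ in $\mathcal A^{\mathbb Z}$. Two subshifts are conjugate if there is a bijective sliding block code from one to the other (equivalently, a homeomorphism commuting with the shift maps). *)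

theory Defs
  imports "HOL-Analysis.Analysis" "HOL-Number_Theory.Cong"
begin

text \<open>The alphabet is a type \<open>'a\<close>, of class \<open>finite\<close> where finiteness is required;
  bi-infinite sequences have type \<open>int \<Rightarrow> 'a\<close>.\<close>

definition shift :: "(int \<Rightarrow> 'a) \<Rightarrow> (int \<Rightarrow> 'a)" where
  "shift x = (\<lambda>i. x (i + 1))"

text \<open>The power of the shift with an arbitrary integer exponent; the two lemmas
  justify the closed form.\<close>

definition shift_power :: "int \<Rightarrow> (int \<Rightarrow> 'a) \<Rightarrow> (int \<Rightarrow> 'a)" where
  "shift_power k x = (\<lambda>i. x (i + k))"

lemma shift_power_of_nat: "shift_power (int n) = shift ^^ n"
proof (induction n)
  case 0
  show ?case by (simp add: shift_power_def fun_eq_iff)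
next
  case (Suc n)
  have "shift (shift_power (int n) x) = shift_power (int (Suc n)) x" for x :: "int \<Rightarrow> 'a"
    by (simp add: shift_power_def shift_def fun_eq_iff algebra_simps)
  then show ?case by (simp add: Suc.IH[symmetric] fun_eq_iff)
qed

lemma shift_power_minus:
  "shift_power (- k) (shift_power k x) = x" "shift_power k (shift_power (- k) x) = x"
  by (simp_all add: shift_power_def)

definition word :: "(int \<Rightarrow> 'a) \<Rightarrow> int \<Rightarrow> int \<Rightarrow> 'a list" where
  "word x i j = map x [i..j]"

definition periodic :: "(int \<Rightarrow> 'a) \<Rightarrow> bool" where
  "periodic x \<longleftrightarrow> (\<exists>N>0. (shift ^^ N) x = x)"

text \<open>Meaningful for periodic sequences only.\<close>

definition least_period :: "(int \<Rightarrow> 'a) \<Rightarrow> nat" where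
  "least_period x = (LEAST N. N > 0 \<and> (shift ^^ N) x = x)"

text \<open>\<open>remove_word x i n\<close> is the sequence obtained from \<open>x\<close> by deleting the word
  \<open>word x (i + 1) (i + int n)\<close>, of length \<open>n\<close>, at the positions \<open>i + 1, \<dots>, i + n\<close>.
  A word together with its position is represented by the pair of \<open>i\<close> and \<open>n\<close>.\<close>

definition remove_word :: "(int \<Rightarrow> 'a) \<Rightarrow> int \<Rightarrow> nat \<Rightarrow> (int \<Rightarrow> 'a)" where
  "remove_word x i n = (\<lambda>k. if k \<le> i then x k else x (k + int n))"

definition is_anomaly :: "(int \<Rightarrow> 'a) \<Rightarrow> int \<Rightarrow> nat \<Rightarrow> bool" where
  "is_anomaly x i n \<longleftrightarrow> n > 0 \<and> periodic (remove_word x i n)"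

definition eventually_periodic :: "(int \<Rightarrow> 'a) \<Rightarrow> bool" where
  "eventually_periodic x \<longleftrightarrow> \<not> periodic x \<and> (\<exists>i n. is_anomaly x i n)"

text \<open>The least period of an eventually periodic sequence, i.e. the common least period
  of all sequences obtained by deleting an anomaly.\<close>

definition eventual_least_period :: "(int \<Rightarrow> 'a) \<Rightarrow> nat" where
  "eventual_least_period x =
     (THE N. \<exists>i n. is_anomaly x i n \<and> N = least_period (remove_word x i n))"

definition anomaly_size :: "(int \<Rightarrow> 'a) \<Rightarrow> nat" where
  "anomaly_size x =
     (LEAST l. \<exists>i n. is_anomaly x i n \<and> l = length (word x (i + 1) (i + int n)))"

definition full_shift_topology :: "(int \<Rightarrow> 'a) topology" where
  "full_shift_topology = product_topology (\<lambda>_. discrete_topology UNIV) UNIV"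

definition generated_subshift :: "(int \<Rightarrow> 'a) \<Rightarrow> (int \<Rightarrow> 'a) set" where
  "generated_subshift x = full_shift_topology closure_of {shift_power k x | k. True}"

text \<open>\<open>m\<close> is the memory, \<open>n\<close> the anticipation and \<open>\<Phi>\<close> the block map. Only the values of
  \<open>\<Phi>\<close> on words of length \<open>m + n + 1\<close> occurring in \<open>X\<close> matter.\<close>

definition sliding_block_code_on ::
  "(int \<Rightarrow> 'a) set \<Rightarrow> ((int \<Rightarrow> 'a) \<Rightarrow> (int \<Rightarrow> 'b)) \<Rightarrow> bool" where
  "sliding_block_code_on X \<phi> \<longleftrightarrow>
     (\<exists>(m::nat) (n::nat) (\<Phi> :: 'a list \<Rightarrow> 'b).
        \<forall>x\<in>X. \<forall>i. \<phi> x i = \<Phi> (word x (i - int m) (i + int n)))"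

definition conjugate :: "(int \<Rightarrow> 'a) set \<Rightarrow> (int \<Rightarrow> 'b) set \<Rightarrow> bool" where
  "conjugate X Y \<longleftrightarrow> (\<exists>\<phi>. sliding_block_code_on X \<phi> \<and> bij_betw \<phi> X Y)"

end

theory Submission
  imports Defs
begin

text \<open>
  An eventually periodic \<open>x\<close> agrees far to the left with a unique periodic sequence \<open>p\<close> of least
  period \<open>N\<close>, and far to the right with \<open>p\<close> delayed by \<open>n\<close> places, where \<open>n\<close> is the length of any
  anomaly; hence \<open>N\<close> and \<open>n\<close> modulo \<open>N\<close> depend on \<open>x\<close> only, and the subshift generated by \<open>x\<close> is
  the union of the orbits of \<open>x\<close> and \<open>p\<close>. An injective sliding block code preserves this
  description, which yields the invariants. Conversely, if \<open>y\<close> is related to \<open>q\<close> in the same way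
  with the same \<open>N\<close> and \<open>n\<close>, then \<open>\<sigma>\<^sup>k x \<mapsto> \<sigma>\<^sup>k y\<close>, \<open>\<sigma>\<^sup>k p \<mapsto> \<sigma>\<^sup>k q\<close> is a sliding block code: the
  finite nonempty set of places \<open>v\<close> with \<open>x v \<noteq> x (v - N)\<close> marks the position in \<open>x\<close>, and away from
  it a window of length \<open>N\<close> determines the phase.
\<close>

section \<open>Powers of the shift, their fixed points, and windows\<close>

lemma shift_power_apply [simp]: "shift_power k x i = x (i + k)"
  by (simp add: shift_power_def)

lemma shift_power_0 [simp]: "shift_power 0 x = x"
  by (simp add: shift_power_def)

lemma shift_power_shift_power [simp]:
  "shift_power k (shift_power l x) = shift_power (k + l) x"
  by (simp add: fun_eq_iff add.assoc add.commute[of k])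

lemma shift_power_inject [simp]: "shift_power k u = shift_power k v \<longleftrightarrow> u = v"
  by (metis shift_power_minus(1))

lemma shift_power_fixed_apply: "shift_power k x = x \<Longrightarrow> x (i + k) = x i"
  by (metis shift_power_apply)

lemma shift_power_eq_iff:
  "shift_power k x = shift_power l x \<longleftrightarrow> shift_power (k - l) x = x"
  by (metis add.commute diff_add_cancel shift_power_inject shift_power_shift_power)

lemma shift_power_mult:
  assumes "shift_power M x = x"
  shows "shift_power (M * t) x = x"
proof -
  have nat: "shift_power (M * int s) x = x" for s
  proof (induction s)
    case (Suc s)
    then have "shift_power (M * int s) (shift_power M x) = x"
      by (simp only: assms)
    then show ?case
      by (simp add: distrib_left add.commute)
  qed simp
  have "shift_power (- (M * int s)) x = x" for s
    by (metis nat shift_power_minus(1))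
  with nat show ?thesis
    by (cases t rule: int_cases2) auto
qed

text \<open>Each place is congruent modulo \<open>M\<close> to one in the window, and both sequences
  are constant on residue classes modulo \<open>M\<close>.\<close>

lemma shift_power_fixed_eqI:
  assumes "0 < M" and "shift_power M u = u" and "shift_power M v = v"
    and eq: "\<And>j. a \<le> j \<Longrightarrow> j < a + M \<Longrightarrow> u j = v j"
  shows "u = v"
proof
  fix j
  define r where "r = a + (j - a) mod M"
  define t where "t = (j - a) div M"
  have "M * t + (j - a) mod M = j - a"
    unfolding t_def by simp
  then have j: "j = r + M * t"
    unfolding r_def by simp
  have "u j = u r" "v j = v r"
    using shift_power_mult[OF assms(2)] shift_power_mult[OF assms(3)] j
    by (simp_all add: shift_power_fixed_apply)
  moreover have "u r = v r"
    using assms(1) by (intro eq) (simp_all add: r_def)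
  ultimately show "u j = v j" by simp
qed

text \<open>A half-line contains a full window of length \<open>M\<close>.\<close>

lemma shift_power_fixed_eq_if_eventually:
  assumes "0 < M" and "shift_power M u = u" and "shift_power M v = v"
    and "(\<forall>\<^sub>F j in at_bot. u j = v j) \<or> (\<forall>\<^sub>F j in at_top. u j = v j)"
  shows "u = v"
  using assms(4)
proof
  assume "\<forall>\<^sub>F j in at_bot. u j = v j"
  then obtain b where "\<forall>j\<le>b. u j = v j"
    by (auto simp: eventually_at_bot_linorder)
  then show ?thesis
    by (intro shift_power_fixed_eqI[OF assms(1-3), of "b - M"]) auto
next
  assume "\<forall>\<^sub>F j in at_top. u j = v j"
  then obtain b where "\<forall>j\<ge>b. u j = v j"
    by (auto simp: eventually_at_top_linorder)
  then show ?thesis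
    by (intro shift_power_fixed_eqI[OF assms(1-3), of b]) auto
qed

text \<open>Turns equality of the words read by a block map at two centres into a condition on
  offsets.\<close>

lemma word_eq_iff:
  "word u (i - m) (i + n) = word v (j - m) (j + n) \<longleftrightarrow>
    (\<forall>d. - m \<le> d \<and> d \<le> n \<longrightarrow> u (i + d) = v (j + d))"
proof
  assume eq: "word u (i - m) (i + n) = word v (j - m) (j + n)"
  show "\<forall>d. - m \<le> d \<and> d \<le> n \<longrightarrow> u (i + d) = v (j + d)"
  proof (intro allI impI)
    fix d assume d: "- m \<le> d \<and> d \<le> n"
    have "word u (i - m) (i + n) ! nat (d + m) = word v (j - m) (j + n) ! nat (d + m)"
      by (simp add: eq)
    with d show "u (i + d) = v (j + d)"
      by (simp add: word_def nth_upto algebra_simps)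
  qed
next
  assume "\<forall>d. - m \<le> d \<and> d \<le> n \<longrightarrow> u (i + d) = v (j + d)"
  then have eq: "u (i + (int k - m)) = v (j + (int k - m))" if "int k \<le> m + n" for k
    using that by simp
  show "word u (i - m) (i + n) = word v (j - m) (j + n)"
  proof (rule nth_equalityI)
    fix k assume "k < length (word u (i - m) (i + n))"
    then have k: "int k \<le> m + n"
      by (simp add: word_def)
    then have "i - m + int k \<le> i + n" "j - m + int k \<le> j + n"
      by linarith+
    then have "word u (i - m) (i + n) ! k = u (i - m + int k)"
      "word v (j - m) (j + n) ! k = v (j - m + int k)"
      by (simp_all add: word_def nth_upto)
    moreover have "i - m + int k = i + (int k - m)" "j - m + int k = j + (int k - m)"
      by simp_all
    ultimately show "word u (i - m) (i + n) ! k = word v (j - m) (j + n) ! k"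
      using eq[OF k] by (simp only:)
  qed (simp add: word_def)
qed


section \<open>The invariants of an eventually periodic sequence\<close>

text \<open>The anomaly length \<open>n\<close> is an arbitrary integer here: only its residue modulo \<open>N\<close> matters.\<close>

definition doubly_asymptotic :: "nat \<Rightarrow> int \<Rightarrow> (int \<Rightarrow> 'a) \<Rightarrow> (int \<Rightarrow> 'a) \<Rightarrow> bool" where
  "doubly_asymptotic N n p x \<longleftrightarrow>
     N > 0 \<and> (\<forall>c. shift_power c p = p \<longleftrightarrow> int N dvd c) \<and>
     (\<forall>\<^sub>F j in at_bot. x j = p j) \<and> (\<forall>\<^sub>F j in at_top. x j = p (j - n)) \<and>
     (\<forall>d. shift_power d x = x \<longrightarrow> d = 0)"

lemma doubly_asymptotic_shift_power_iff:
  assumes "doubly_asymptotic N n p x"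
  shows "shift_power c p = shift_power d p \<longleftrightarrow> int N dvd c - d"
  using assms shift_power_eq_iff[of c p d] by (simp add: doubly_asymptotic_def)

text \<open>A negative exponent is as good as a positive one: \<open>d * sgn d\<close> is the
  absolute value of \<open>d\<close>, and multiples of a fixing exponent also fix
  \<open>x\<close>.\<close>

lemma periodic_iff_shift_power: "periodic x \<longleftrightarrow> (\<exists>d. d \<noteq> 0 \<and> shift_power d x = x)"
proof
  assume "periodic x"
  then show "\<exists>d. d \<noteq> 0 \<and> shift_power d x = x"
    unfolding periodic_def by (metis of_nat_0_less_iff order_less_irrefl shift_power_of_nat)
next
  assume "\<exists>d. d \<noteq> 0 \<and> shift_power d x = x"
  then obtain d where "d \<noteq> 0" "shift_power d x = x"
    by blast
  then have "nat \<bar>d\<bar> > 0" "shift_power (int (nat \<bar>d\<bar>)) x = x"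
    using shift_power_mult[of d x "sgn d"] by (simp_all add: abs_sgn[symmetric])
  then show "periodic x"
    unfolding periodic_def shift_power_of_nat by blast
qed

text \<open>Division with remainder: the remainder of a fixing exponent also fixes \<open>p\<close>
  and is below the least positive one, hence is 0.\<close>

lemma shift_power_fixed_iff_least_period_dvd:
  assumes "periodic p"
  shows "least_period p > 0" and "shift_power c p = p \<longleftrightarrow> int (least_period p) dvd c"
proof -
  let ?N = "least_period p"
  have N: "?N > 0" "(shift ^^ ?N) p = p"
    using assms LeastI_ex[of "\<lambda>N. N > 0 \<and> (shift ^^ N) p = p"]
    unfolding periodic_def least_period_def by blast+
  show "?N > 0" by (fact N)
  have fixed: "shift_power (int ?N * t) p = p" for t
    using N(2) by (intro shift_power_mult) (simp add: shift_power_of_nat)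
  show "shift_power c p = p \<longleftrightarrow> int ?N dvd c"
  proof
    assume c: "shift_power c p = p"
    define r where "r = nat (c mod int ?N)"
    have r: "int r = c mod int ?N"
      using N(1) by (simp add: r_def)
    have "shift_power (int r + int ?N * (c div int ?N)) p = p"
      using c r by simp
    then have "shift_power (int r) p = p"
      by (metis fixed shift_power_shift_power)
    then have "(shift ^^ r) p = p"
      by (simp add: shift_power_of_nat)
    moreover have "r < ?N"
      using r N(1) by (metis of_nat_0_less_iff of_nat_less_iff pos_mod_bound)
    ultimately have "r = 0"
      using not_less_Least[of r "\<lambda>N. N > 0 \<and> (shift ^^ N) p = p"]
      unfolding least_period_def by auto
    then show "int ?N dvd c"
      using r by auto
  qed (auto simp: fixed)
qed

text \<open>Deletion leaves the left part in place and pulls the right part back by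
  \<open>n\<close>, so \<open>x\<close> itself follows the deleted sequence with delay
  \<open>n\<close> on the right.\<close>

lemma doubly_asymptotic_remove_word:
  assumes "\<not> periodic x" and "is_anomaly x i n"
  shows "doubly_asymptotic (least_period (remove_word x i n)) (int n) (remove_word x i n) x"
proof -
  have "periodic (remove_word x i n)"
    using assms(2) by (simp add: is_anomaly_def)
  moreover have "\<forall>\<^sub>F j in at_bot. x j = remove_word x i n j"
    unfolding eventually_at_bot_linorder remove_word_def by (intro exI[of _ i]) simp
  moreover have "\<forall>\<^sub>F j in at_top. x j = remove_word x i n (j - int n)"
    \<comment> \<open>From this place on \<open>j - int n > i\<close>, so the second branch of the
      deletion applies.\<close>
    unfolding eventually_at_top_linorder remove_word_def by (intro exI[of _ "i + int n + 1"]) simp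
  ultimately show ?thesis
    using assms(1) unfolding doubly_asymptotic_def periodic_iff_shift_power[of x]
    by (auto simp: shift_power_fixed_iff_least_period_dvd)
qed

text \<open>The left tail of \<open>x\<close> determines \<open>p\<close>, hence \<open>N\<close>;
  the right tail then determines the delayed copy of \<open>p\<close>, hence the delay modulo
  \<open>N\<close>.\<close>

lemma doubly_asymptotic_unique:
  assumes "doubly_asymptotic N n p x" and "doubly_asymptotic N' n' p' x"
  shows "N = N'" and "[n = n'] (mod int N)"
proof -
  note da = assms[unfolded doubly_asymptotic_def]
  have "p = p'"
  proof (rule shift_power_fixed_eq_if_eventually)
    \<comment> \<open>The product serves as a common period, since \<open>N = N'\<close> is not yet
      known.\<close>
    show "0 < int N * int N'" using da by simp
    show "shift_power (int N * int N') p = p" "shift_power (int N * int N') p' = p'"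
      using da by (metis dvd_triv_left, metis dvd_triv_right)
    have "\<forall>\<^sub>F j in at_bot. x j = p j" "\<forall>\<^sub>F j in at_bot. x j = p' j"
      using da by auto
    then have "\<forall>\<^sub>F j in at_bot. p j = p' j"
      by eventually_elim simp
    then show "(\<forall>\<^sub>F j in at_bot. p j = p' j) \<or> (\<forall>\<^sub>F j in at_top. p j = p' j)" ..
  qed
  then show "N = N'"
    using da by (metis dvd_antisym dvd_refl int_dvd_int_iff)
  have pN: "shift_power (int N) p = p"
    using da by simp
  have "shift_power (- n) p = shift_power (- n') p"
  proof (rule shift_power_fixed_eq_if_eventually)
    show "0 < int N" using da by simp
    show "shift_power (int N) (shift_power (- n) p) = shift_power (- n) p"
      "shift_power (int N) (shift_power (- n') p) = shift_power (- n') p"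
      using pN by (metis add.commute shift_power_shift_power)+
    have "\<forall>\<^sub>F j in at_top. x j = p (j - n)" "\<forall>\<^sub>F j in at_top. x j = p (j - n')"
      using da \<open>p = p'\<close> by auto
    then have "\<forall>\<^sub>F j in at_top. shift_power (- n) p j = shift_power (- n') p j"
      by eventually_elim simp
    then show "(\<forall>\<^sub>F j in at_bot. shift_power (- n) p j = shift_power (- n') p j) \<or>
        (\<forall>\<^sub>F j in at_top. shift_power (- n) p j = shift_power (- n') p j)" ..
  qed
  then have "int N dvd - n - - n'"
    by (simp only: doubly_asymptotic_shift_power_iff[OF assms(1)])
  then show "[n = n'] (mod int N)"
    by (simp add: cong_iff_dvd_diff dvd_diff_commute)
qed

text \<open>The bridge from the given definitions. An anomaly of minimal length is chosen, and
  uniqueness shows that the description defining \<open>eventual_least_period\<close> denotes its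
  period.\<close>

lemma eventually_periodic_doubly_asymptotic:
  assumes "eventually_periodic x"
  obtains p where "doubly_asymptotic (eventual_least_period x) (int (anomaly_size x)) p x"
proof -
  have np: "\<not> periodic x" and ex: "\<exists>i n. is_anomaly x i n"
    using assms by (auto simp: eventually_periodic_def)
  have len: "length (word x (i + 1) (i + int n)) = n" for i n
    by (simp add: word_def)
  obtain i where i: "is_anomaly x i (anomaly_size x)"
    using LeastI_ex[of "\<lambda>l. \<exists>i n. is_anomaly x i n \<and> l = n"] ex
    unfolding anomaly_size_def len by blast
  note da = doubly_asymptotic_remove_word[OF np]
  have "eventual_least_period x = least_period (remove_word x i (anomaly_size x))"
    unfolding eventual_least_period_def
    using i da doubly_asymptotic_unique(1) by (intro the_equality) blast+
  then show thesis
    using that da[OF i] by metis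
qed

lemma doubly_asymptotic_shift_power:
  assumes "doubly_asymptotic N n p x"
  shows "doubly_asymptotic N n (shift_power k p) (shift_power k x)"
proof -
  note da = assms[unfolded doubly_asymptotic_def]
  have fixed: "shift_power c (shift_power k u) = shift_power k u \<longleftrightarrow> shift_power c u = u"
    for c and u :: "int \<Rightarrow> 'a"
    by (metis add.commute shift_power_inject shift_power_shift_power)
  obtain A where A: "\<forall>j\<le>A. x j = p j"
    using da by (auto simp: eventually_at_bot_linorder)
  obtain B where B: "\<forall>j\<ge>B. x j = p (j - n)"
    using da by (auto simp: eventually_at_top_linorder)
  have "\<forall>\<^sub>F j in at_bot. shift_power k x j = shift_power k p j"
    unfolding eventually_at_bot_linorder using A by (intro exI[of _ "A - k"]) simp
  moreover have "\<forall>\<^sub>F j in at_top. shift_power k x j = shift_power k p (j - n)"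
    unfolding eventually_at_top_linorder using B
    by (intro exI[of _ "B - k"]) (simp add: algebra_simps)
  ultimately show ?thesis
    using da by (simp add: doubly_asymptotic_def fixed del: shift_power_shift_power)
qed

section \<open>Images under injective sliding block codes\<close>

text \<open>The code commutes with shifts on the two orbits, so by injectivity it preserves fixing
  exponents. Having a bounded window, it preserves both tail relations, delay included.\<close>

lemma doubly_asymptotic_image:
  assumes da: "doubly_asymptotic N n p x"
    and code: "sliding_block_code_on X \<phi>" and inj: "inj_on \<phi> X"
    and orbits: "\<And>k. shift_power k x \<in> X" "\<And>k. shift_power k p \<in> X"
  shows "doubly_asymptotic N n (\<phi> p) (\<phi> x)"
proof -
  note da = da[unfolded doubly_asymptotic_def]
  obtain m m' \<Phi> where \<Phi>: "\<And>z i. z \<in> X \<Longrightarrow> \<phi> z i = \<Phi> (word z (i - int m) (i + int m'))"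
    using code unfolding sliding_block_code_on_def by blast
  have local: "\<phi> u i = \<phi> v j"
    if "u \<in> X" "v \<in> X" "\<And>d. - int m \<le> d \<Longrightarrow> d \<le> int m' \<Longrightarrow> u (i + d) = v (j + d)" for u v i j
    using that \<Phi> word_eq_iff[of u i "int m" "int m'" v j] by metis
  have xX: "x \<in> X" and pX: "p \<in> X"
    using orbits[of 0] by simp_all
  have fixed: "shift_power c (\<phi> u) = \<phi> u \<longleftrightarrow> shift_power c u = u"
    if u: "\<And>k. shift_power k u \<in> X" for c u
  proof -
    have uX: "u \<in> X" using u[of 0] by simp
    have "shift_power c (\<phi> u) = \<phi> (shift_power c u)"
    proof
      show "shift_power c (\<phi> u) i = \<phi> (shift_power c u) i" for i
        using local[OF uX u[of c], of "i + c" i] by (simp add: algebra_simps)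
    qed
    then show ?thesis
      using inj uX u by (simp add: inj_on_eq_iff)
  qed
  obtain A where A: "\<forall>j\<le>A. x j = p j"
    using da by (auto simp: eventually_at_bot_linorder)
  obtain B where B: "\<forall>j\<ge>B. x j = p (j - n)"
    using da by (auto simp: eventually_at_top_linorder)
  \<comment> \<open>The window at \<open>j\<close> reaches \<open>int m'\<close> places to the
    right, so the bound moves left by that amount; on the right-hand tail the memory
    \<open>m\<close> plays this role.\<close>
  have "\<phi> x j = \<phi> p j" if "j \<le> A - int m'" for j
    using that A by (intro local[OF xX pX]) simp
  then have "\<forall>\<^sub>F j in at_bot. \<phi> x j = \<phi> p j"
    unfolding eventually_at_bot_linorder by blast
  moreover have "\<phi> x j = \<phi> p (j - n)" if "j \<ge> B + int m" for j
    using that B by (intro local[OF xX pX]) (simp add: algebra_simps)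
  then have "\<forall>\<^sub>F j in at_top. \<phi> x j = \<phi> p (j - n)"
    unfolding eventually_at_top_linorder by blast
  ultimately show ?thesis
    using da by (simp add: doubly_asymptotic_def fixed[OF orbits(1)] fixed[OF orbits(2)])
qed

section \<open>The subshift as the union of two orbits\<close>

text \<open>Otherwise \<open>N\<close> would be a nonzero period of \<open>x\<close>. Such places,
  called defects below, locate a shift of \<open>x\<close> in its orbit.\<close>

lemma doubly_asymptotic_nonempty_defects:
  assumes "doubly_asymptotic N n p x"
  shows "\<exists>v. x v \<noteq> x (v - int N)"
proof (rule ccontr)
  assume "\<not> ?thesis"
  then have "x (v + int N) = x v" for v
    by (metis add_diff_cancel_right')
  then have "shift_power (int N) x = x"
    by (simp add: fun_eq_iff)
  then show False
    using assms by (auto simp: doubly_asymptotic_def)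
qed

text \<open>Holding for all large \<open>K\<close>, it gives one bound for two sequences at once.
  With \<open>int N - K\<close>, a window of length \<open>N\<close> starting left of
  \<open>- K\<close> lies wholly in the left zone.\<close>

lemma eventually_zones:
  assumes "doubly_asymptotic N n p x"
  shows "\<forall>\<^sub>F K in at_top. (\<forall>j\<le>int N - K. x j = p j) \<and> (\<forall>j\<ge>K. x j = p (j - n)) \<and>
    (\<forall>v. x v \<noteq> x (v - int N) \<longrightarrow> \<bar>v\<bar> \<le> K)"
proof -
  note da = assms[unfolded doubly_asymptotic_def]
  obtain A where A: "\<forall>j\<le>A. x j = p j"
    using da by (auto simp: eventually_at_bot_linorder)
  obtain B where B: "\<forall>j\<ge>B. x j = p (j - n)"
    using da by (auto simp: eventually_at_top_linorder)
  have "shift_power (int N) p = p"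
    using da by simp
  then have pN: "p (j - int N) = p j" for j
    using shift_power_fixed_apply[of "int N" p "j - int N"] by simp
  have left: "x v = x (v - int N)" if "v \<le> A" for v
    using that A pN by simp
  \<comment> \<open>The extra \<open>int N\<close> keeps \<open>v - int N\<close> at or beyond
    \<open>B\<close> too.\<close>
  have right: "x v = x (v - int N)" if "v \<ge> B + int N" for v
    using that B pN[of "v - n"] by (simp add: algebra_simps)
  have "(\<forall>j\<le>int N - K. x j = p j) \<and> (\<forall>j\<ge>K. x j = p (j - n)) \<and>
    (\<forall>v. x v \<noteq> x (v - int N) \<longrightarrow> \<bar>v\<bar> \<le> K)" if K: "K \<ge> \<bar>A\<bar> + \<bar>B\<bar> + int N" for K
  proof (intro conjI allI impI)
    fix v assume "x v \<noteq> x (v - int N)"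
    then have "v > A" "v < B + int N"
      using left right by (meson not_le)+
    then show "\<bar>v\<bar> \<le> K"
      using K by linarith
  next
    fix j assume "j \<le> int N - K"
    then show "x j = p j"
      using A K by simp
  next
    fix j assume "j \<ge> K"
    then show "x j = p (j - n)"
      using B K by simp
  qed
  then show ?thesis
    unfolding eventually_at_top_linorder by blast
qed

text \<open>A basic open set constrains only finitely many coordinates, so closeness in the product
  topology is agreement on a central window.\<close>

lemma in_generated_subshift_iff:
  "z \<in> generated_subshift x \<longleftrightarrow> (\<forall>m. \<exists>k. \<forall>j. \<bar>j\<bar> \<le> m \<longrightarrow> z j = x (j + k))"
proof
  assume z: "z \<in> generated_subshift x"
  show "\<forall>m. \<exists>k. \<forall>j. \<bar>j\<bar> \<le> m \<longrightarrow> z j = x (j + k)"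
  proof
    fix m :: int
    define U where "U = Pi\<^sub>E UNIV (\<lambda>j. if \<bar>j\<bar> \<le> m then {z j} else UNIV)"
    have "finite {j. \<bar>j\<bar> \<le> m}"
      by (rule finite_subset[of _ "{-m..m}"]) auto
    then have "openin full_shift_topology U"
      unfolding full_shift_topology_def U_def
      by (subst openin_PiE_gen) (auto simp: PiE_eq_empty_iff elim: rev_finite_subset)
    moreover have "z \<in> U"
      by (simp add: U_def PiE_iff)
    ultimately obtain k where "shift_power k x \<in> U"
      using z unfolding generated_subshift_def in_closure_of by blast
    then have "\<forall>j. \<bar>j\<bar> \<le> m \<longrightarrow> shift_power k x j = z j"
      unfolding U_def PiE_iff by (metis UNIV_I singletonD)
    then show "\<exists>k. \<forall>j. \<bar>j\<bar> \<le> m \<longrightarrow> z j = x (j + k)"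
      by (metis shift_power_apply)
  qed
next
  assume z: "\<forall>m. \<exists>k. \<forall>j. \<bar>j\<bar> \<le> m \<longrightarrow> z j = x (j + k)"
  show "z \<in> generated_subshift x"
    unfolding generated_subshift_def in_closure_of
  proof (intro conjI allI impI)
    show "z \<in> topspace full_shift_topology"
      by (simp add: full_shift_topology_def)
  next
    fix T assume "z \<in> T \<and> openin full_shift_topology T"
    then obtain W where W: "finite {i. W i \<noteq> UNIV}" "z \<in> Pi\<^sub>E UNIV W" "Pi\<^sub>E UNIV W \<subseteq> T"
      unfolding full_shift_topology_def openin_product_topology_alt by auto
    then obtain m where m: "\<And>i. W i \<noteq> UNIV \<Longrightarrow> \<bar>i\<bar> \<le> m"
      using Max_ge[of "abs ` {i. W i \<noteq> UNIV}"] by (metis (mono_tags, lifting) finite_imageI image_eqI mem_Collect_eq)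
    obtain k where k: "\<forall>j. \<bar>j\<bar> \<le> m \<longrightarrow> z j = x (j + k)"
      using z by blast
    have "shift_power k x i \<in> W i" for i
    proof (cases "W i = UNIV")
      case False
      with m k have "shift_power k x i = z i"
        by simp
      then show ?thesis
        using W(2) by (simp only:) blast
    qed simp
    then have "shift_power k x \<in> T"
      using W(3) by (auto simp: PiE_iff)
    then show "\<exists>w. w \<in> {shift_power k x | k. True} \<and> w \<in> T"
      by blast
  qed
qed

text \<open>If a limit \<open>z\<close> of shifts of \<open>x\<close> has a defect, only finitely
  many shifts can approximate it, so it is one of them. Otherwise \<open>z\<close> has period
  \<open>N\<close> and copies a window from a periodic tail. Conversely, \<open>p\<close> is
  approximated far out in the left tail.\<close>

lemma generated_subshift_eq_orbits:
  assumes "doubly_asymptotic N n p x"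
  shows "generated_subshift x = range (\<lambda>k. shift_power k x) \<union> range (\<lambda>k. shift_power k p)"
proof (intro equalityI subsetI)
  note da = assms[unfolded doubly_asymptotic_def]
  obtain K where left: "\<forall>j\<le>int N - K. x j = p j" and right: "\<forall>j\<ge>K. x j = p (j - n)"
    and V: "\<forall>v. x v \<noteq> x (v - int N) \<longrightarrow> \<bar>v\<bar> \<le> K"
    using eventually_zones[OF assms] by (auto simp: eventually_at_top_linorder)
  have pN: "shift_power (int N) p = p"
    using da by simp
  {
    fix z assume "z \<in> generated_subshift x"
    then have z: "\<exists>k. \<forall>j. \<bar>j\<bar> \<le> m \<longrightarrow> z j = x (j + k)" for m
      by (simp add: in_generated_subshift_iff)
    show "z \<in> range (\<lambda>k. shift_power k x) \<union> range (\<lambda>k. shift_power k p)"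
    proof (cases "\<exists>j. z j \<noteq> z (j - int N)")
      case True
      then obtain j where j: "z j \<noteq> z (j - int N)"
        by blast
      show ?thesis
      proof (rule ccontr)
        assume "\<not> ?thesis"
        then have "\<forall>k. \<exists>i. z i \<noteq> x (i + k)"
          by (metis UnI1 ext rangeI shift_power_apply)
        then obtain f where f: "\<And>k. z (f k) \<noteq> x (f k + k)"
          by metis
        \<comment> \<open>A defect of \<open>z\<close> at \<open>j\<close> forces
          \<open>j + k\<close> to be a defect of \<open>x\<close>, so only these \<open>k\<close>
          are possible. The radius \<open>m\<close> exposes the disagreement \<open>f k\<close> for
          each of them, as well as \<open>j\<close> and \<open>j - int N\<close>.\<close>
        define F where "F = (\<lambda>k. \<bar>f k\<bar>) ` {- K - j..K - j}"
        define m where "m = Max (insert (\<bar>j\<bar> + int N) F)"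
        have "finite F"
          by (simp add: F_def)
        then have Fm: "i \<le> m" if "i \<in> insert (\<bar>j\<bar> + int N) F" for i
          using that unfolding m_def by (intro Max_ge) simp_all
        then have m: "\<bar>j\<bar> + int N \<le> m"
          by blast
        obtain k where k: "\<forall>j. \<bar>j\<bar> \<le> m \<longrightarrow> z j = x (j + k)"
          using z by blast
        have "x (j + k) \<noteq> x (j + k - int N)"
          using k[rule_format, of j] k[rule_format, of "j - int N"] j m
          by (simp add: algebra_simps)
        then have "\<bar>j + k\<bar> \<le> K"
          using V by blast
        then have "\<bar>f k\<bar> \<le> m"
          by (intro Fm insertI2, unfold F_def, intro imageI) auto
        then show False
          using f k by blast
      qed
    next
      case False
      then have zN: "shift_power (int N) z = z"
        by (metis add_diff_cancel_right' ext shift_power_apply)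
      have orbit: "z = shift_power c p" if "\<And>j. 0 \<le> j \<Longrightarrow> j < int N \<Longrightarrow> z j = p (j + c)" for c
      proof (rule shift_power_fixed_eqI[OF _ zN, of _ 0])
        show "shift_power (int N) (shift_power c p) = shift_power c p"
          using pN by (metis add.commute shift_power_shift_power)
      qed (use da that in auto)
      \<comment> \<open>The radius lets the window show \<open>v - k\<close> and
        \<open>v - k - int N\<close> whenever \<open>v\<close> and \<open>k\<close> are at most
        \<open>K\<close> in absolute value; a \<open>k\<close> so close to 0 would then give
        \<open>z\<close> a defect.\<close>
      obtain k where k: "\<forall>j. \<bar>j\<bar> \<le> 2 * K + int N \<longrightarrow> z j = x (j + k)"
        using z by blast
      obtain v where v: "x v \<noteq> x (v - int N)"
        using doubly_asymptotic_nonempty_defects[OF assms] by blast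
      then have vK: "\<bar>v\<bar> \<le> K"
        using V by blast
      consider "k < - K" | "k > K" | "\<bar>k\<bar> \<le> K"
        by linarith
      then show ?thesis
      proof cases
        case 1
        then have "z = shift_power k p"
          using left k vK by (intro orbit) simp
        then show ?thesis by blast
      next
        case 2
        then have "z = shift_power (k - n) p"
          using right k vK by (intro orbit) (simp add: algebra_simps)
        then show ?thesis by blast
      next
        case 3
        then have "z (v - k) = x v" "z (v - k - int N) = x (v - int N)"
          using k[rule_format, of "v - k"] k[rule_format, of "v - k - int N"] vK
          by (simp_all add: algebra_simps)
        with v False show ?thesis
          by metis
      qed
    qed
  }
  fix z assume "z \<in> range (\<lambda>k. shift_power k x) \<union> range (\<lambda>k. shift_power k p)"
  then show "z \<in> generated_subshift x"
  proof
    assume "z \<in> range (\<lambda>k. shift_power k x)"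
    then show ?thesis
      by (auto simp: in_generated_subshift_iff)
  next
    assume "z \<in> range (\<lambda>k. shift_power k p)"
    then obtain k where zk: "z = shift_power k p"
      by blast
    show ?thesis
      unfolding in_generated_subshift_iff
    proof
      fix m :: int
      \<comment> \<open>Moving left by \<open>int N * t\<close> keeps the phase of \<open>p\<close>
        and, as \<open>N\<close> is at least 1, carries the whole window into the left zone.\<close>
      define t where "t = \<bar>m\<bar> + \<bar>k\<bar> + \<bar>K\<bar>"
      have "t \<le> int N * t"
        using da mult_right_mono[of 1 "int N" t] by (simp add: t_def)
      then have "x (j + (k - int N * t)) = p (j + k)" if "\<bar>j\<bar> \<le> m" for j
        using that left[rule_format, of "j + (k - int N * t)"]
          shift_power_fixed_apply[OF shift_power_mult[OF pN, of "- t"], of "j + k"]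
        by (simp add: t_def algebra_simps)
      then have "\<forall>j. \<bar>j\<bar> \<le> m \<longrightarrow> z j = x (j + (k - int N * t))"
        by (simp add: zk)
      then show "\<exists>k. \<forall>j. \<bar>j\<bar> \<le> m \<longrightarrow> z j = x (j + k)" ..
    qed
  qed
qed

section \<open>The conjugacy built from equal invariants\<close>

text \<open>The graph of the intended map on one orbit. A relation is used because single-valuedness
  is still to be proved, and because exchanging \<open>x\<close> and \<open>y\<close> merely
  reverses it.\<close>

definition orbit_pairs ::
  "(int \<Rightarrow> 'a) \<Rightarrow> (int \<Rightarrow> 'b) \<Rightarrow> ((int \<Rightarrow> 'a) \<times> (int \<Rightarrow> 'b)) set" where
  "orbit_pairs x y = range (\<lambda>k. (shift_power k x, shift_power k y))"

lemma orbit_pairs_shift_power: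
  "(u, v) \<in> orbit_pairs x y \<Longrightarrow> (shift_power k u, shift_power k v) \<in> orbit_pairs x y"
  by (auto simp: orbit_pairs_def)

text \<open>The block map in relational form; by simultaneous shifting, place 0 is enough. A window
  either shows all defects of \<open>x\<close> and so fixes the shift, or yields a phase modulo
  \<open>N\<close> that determines the output letter.\<close>

lemma orbit_pairs_window:
  fixes x p :: "int \<Rightarrow> 'a" and y q :: "int \<Rightarrow> 'b"
  assumes x: "doubly_asymptotic N n p x" and y: "doubly_asymptotic N n q y"
  obtains m :: nat where "\<And>u v u' v'. (u, v) \<in> orbit_pairs x y \<union> orbit_pairs p q \<Longrightarrow>
    (u', v') \<in> orbit_pairs x y \<union> orbit_pairs p q \<Longrightarrow> \<forall>j. \<bar>j\<bar> \<le> int m \<longrightarrow> u j = u' j \<Longrightarrow> v 0 = v' 0"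
proof -
  let ?R = "orbit_pairs x y \<union> orbit_pairs p q"
  note dx = x[unfolded doubly_asymptotic_def] and dy = y[unfolded doubly_asymptotic_def]
  obtain K where left: "\<forall>j\<le>int N - K. x j = p j" "\<forall>j\<le>int N - K. y j = q j"
    and right: "\<forall>j\<ge>K. x j = p (j - n)" "\<forall>j\<ge>K. y j = q (j - n)"
    and V: "\<And>v. x v \<noteq> x (v - int N) \<Longrightarrow> \<bar>v\<bar> \<le> K"
    using eventually_conj[OF eventually_zones[OF x] eventually_zones[OF y]]
    by (auto simp: eventually_at_top_linorder)
  define V where "V = {v. x v \<noteq> x (v - int N)}"
  have "V \<noteq> {}"
    using doubly_asymptotic_nonempty_defects[OF x] by (auto simp: V_def)
  have VK: "\<bar>v\<bar> \<le> K" if "v \<in> V" for v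
    using V that by (simp add: V_def)
  then have "V \<subseteq> {-K..K}"
    by fastforce
  then have "finite V"
    by (rule finite_subset) simp
  have "K \<ge> 0"
    using VK \<open>V \<noteq> {}\<close> by fastforce
  \<comment> \<open>Chosen so that, for a shift by \<open>k\<close> within \<open>K\<close>, every
    defect and the place \<open>N\<close> before it are visible.\<close>
  define m where "m = nat (2 * K) + N"
  have m: "int m = 2 * K + int N"
    using \<open>K \<ge> 0\<close> by (simp add: m_def)
  define regular where "regular u v \<longleftrightarrow>
    (\<exists>c. (\<forall>j. 0 \<le> j \<and> j < int N \<longrightarrow> u j = p (j + c)) \<and> v 0 = q c)"
    for u :: "int \<Rightarrow> 'a" and v :: "int \<Rightarrow> 'b"
  define central where "central u v \<longleftrightarrow>
    (\<exists>k. \<bar>k\<bar> \<le> K \<and> u = shift_power k x \<and> v = shift_power k y)"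
    for u :: "int \<Rightarrow> 'a" and v :: "int \<Rightarrow> 'b"
  have cases: "regular u v \<or> central u v" if uv: "(u, v) \<in> ?R" for u v
    using uv
  proof
    assume "(u, v) \<in> orbit_pairs x y"
    then obtain k where k: "u = shift_power k x" "v = shift_power k y"
      by (auto simp: orbit_pairs_def)
    consider "k < - K" | "k > K" | "\<bar>k\<bar> \<le> K"
      by linarith
    then show ?thesis
    proof cases
      case 1
      then have "regular u v"
        unfolding regular_def k using left by (intro exI[of _ k]) simp
      then show ?thesis ..
    next
      case 2
      \<comment> \<open>The delay \<open>n\<close> is common to \<open>x\<close> and
        \<open>y\<close>, so the single phase \<open>k - n\<close> serves both components.\<close>
      then have "regular u v"
        unfolding regular_def k using right
        by (intro exI[of _ "k - n"]) (simp add: algebra_simps)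
      then show ?thesis ..
    next
      case 3
      then show ?thesis
        using k by (auto simp: central_def)
    qed
  next
    assume "(u, v) \<in> orbit_pairs p q"
    then show ?thesis
      by (auto simp: orbit_pairs_def regular_def)
  qed
  have central: "v = v'"
    if uv: "central u v" and uv': "(u', v') \<in> ?R" and eq: "\<forall>j. \<bar>j\<bar> \<le> int m \<longrightarrow> u j = u' j"
    for u v u' v'
  proof -
    obtain k where k: "\<bar>k\<bar> \<le> K" "u = shift_power k x" "v = shift_power k y"
      using uv by (auto simp: central_def)
    \<comment> \<open>The window of \<open>u\<close> shows all its defects, so \<open>u'\<close>
      inherits them at the same places; this excludes shifts of \<open>p\<close>.\<close>
    have jump: "u' (w - k) \<noteq> u' (w - k - int N)" if "w \<in> V" for w
    proof -
      have "u' (w - k) = x w" "u' (w - k - int N) = x (w - int N)"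
        using eq[rule_format, of "w - k"] eq[rule_format, of "w - k - int N"] k VK[OF that]
        by (simp_all add: m)
      then show ?thesis
        using that by (simp add: V_def)
    qed
    have "(u', v') \<notin> orbit_pairs p q"
    proof
      assume "(u', v') \<in> orbit_pairs p q"
      then obtain l where l: "u' = shift_power l p"
        by (auto simp: orbit_pairs_def)
      obtain w where "w \<in> V"
        using \<open>V \<noteq> {}\<close> by blast
      moreover have "shift_power (int N) p = p"
        using dx by simp
      then have "p (w - k - int N + l) = p (w - k + l)"
        using shift_power_fixed_apply[of "int N" p "w - k - int N + l"]
        by (simp add: algebra_simps)
      ultimately show False
        using jump[of w] by (simp add: l)
    qed
    then obtain l where l: "u' = shift_power l x" "v' = shift_power l y"
      using uv' by (auto simp: orbit_pairs_def)
    have "w + (l - k) \<in> V" if "w \<in> V" for w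
      using jump[OF that] by (simp add: V_def l algebra_simps)
    \<comment> \<open>A translation mapping a finite nonempty set into itself is trivial: the
      maximum excludes \<open>l > k\<close>, the minimum \<open>l < k\<close>.\<close>
    then have "Max V + (l - k) \<le> Max V" "Min V \<le> Min V + (l - k)"
      using \<open>finite V\<close> \<open>V \<noteq> {}\<close> by (meson Max_ge Max_in, meson Min_le Min_in)
    then have "k = l"
      by linarith
    then show "v = v'"
      by (simp add: k l)
  qed
  have regular: "v 0 = v' 0"
    if uv: "regular u v" "regular u' v'" and eq: "\<forall>j. \<bar>j\<bar> \<le> int m \<longrightarrow> u j = u' j"
    for u v u' v'
  proof -
    obtain c where c: "\<forall>j. 0 \<le> j \<and> j < int N \<longrightarrow> u j = p (j + c)" "v 0 = q c"
      using uv by (auto simp: regular_def)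
    obtain d where d: "\<forall>j. 0 \<le> j \<and> j < int N \<longrightarrow> u' j = p (j + d)" "v' 0 = q d"
      using uv by (auto simp: regular_def)
    have pN: "shift_power (int N) (shift_power e p) = shift_power e p" for e
    proof -
      have "shift_power (int N) p = p"
        using dx by simp
      then show ?thesis
        by (metis add.commute shift_power_shift_power)
    qed
    have "shift_power c p = shift_power d p"
    proof (rule shift_power_fixed_eqI[OF _ pN pN, of 0])
      show "0 < int N"
        using dx by simp
      show "shift_power c p j = shift_power d p j" if "0 \<le> j" "j < 0 + int N" for j
        using that c(1) d(1) eq m \<open>K \<ge> 0\<close> by simp
    qed
    \<comment> \<open>Both equalities mean \<open>int N dvd c - d\<close>, because \<open>p\<close>
      and \<open>q\<close> have the same least period.\<close>
    then have "shift_power c q = shift_power d q"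
      by (simp only: doubly_asymptotic_shift_power_iff[OF x] doubly_asymptotic_shift_power_iff[OF y])
    then have "q c = q d"
      by (metis add_0 shift_power_apply)
    then show ?thesis
      by (simp add: c d)
  qed
  show thesis
  proof (rule that)
    fix u v u' v'
    assume uv: "(u, v) \<in> ?R" "(u', v') \<in> ?R" and eq: "\<forall>j. \<bar>j\<bar> \<le> int m \<longrightarrow> u j = u' j"
    then have eq': "\<forall>j. \<bar>j\<bar> \<le> int m \<longrightarrow> u' j = u j"
      by simp
    show "v 0 = v' 0"
      using cases[OF uv(1)] cases[OF uv(2)] central[OF _ uv(2) eq] central[OF _ uv(1) eq']
        regular[OF _ _ eq] by blast
  qed
qed

text \<open>Equal first components agree on every window, so the window property applies after each
  shift.\<close>

lemma orbit_pairs_single_valued: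
  assumes x: "doubly_asymptotic N n p x" and y: "doubly_asymptotic N n q y"
    and uv: "(u, v) \<in> orbit_pairs x y \<union> orbit_pairs p q"
      "(u, v') \<in> orbit_pairs x y \<union> orbit_pairs p q"
  shows "v = v'"
proof
  fix k
  have "(shift_power k u, shift_power k v) \<in> orbit_pairs x y \<union> orbit_pairs p q"
    "(shift_power k u, shift_power k v') \<in> orbit_pairs x y \<union> orbit_pairs p q"
    using uv orbit_pairs_shift_power by blast+
  then have "shift_power k v 0 = shift_power k v' 0"
    using orbit_pairs_window[OF x y] by metis
  then show "v k = v' k"
    by simp
qed

text \<open>The block map chooses an output observed for the given word; the assumption makes it
  unique for words that occur, and other words do not matter.\<close>

lemma sliding_block_code_onI:
  assumes "\<And>u v i j. u \<in> X \<Longrightarrow> v \<in> X \<Longrightarrow>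
    word u (i - int m) (i + int n) = word v (j - int m) (j + int n) \<Longrightarrow> \<phi> u i = \<phi> v j"
  shows "sliding_block_code_on X \<phi>"
  unfolding sliding_block_code_on_def
proof (intro exI ballI allI)
  let ?P = "\<lambda>w c. \<exists>v\<in>X. \<exists>j. word v (j - int m) (j + int n) = w \<and> \<phi> v j = c"
  fix u i assume "u \<in> X"
  then have "?P (word u (i - int m) (i + int n)) (\<phi> u i)"
    by blast
  then show "\<phi> u i = (\<lambda>w. SOME c. ?P w c) (word u (i - int m) (i + int n))"
    using assms \<open>u \<in> X\<close> by (intro some_equality[symmetric]) (assumption, metis)
qed

text \<open>The relation \<open>?R\<close> is the graph of a function, and so is its converse by
  exchanging the two sequences; the window property makes the function a block code.\<close>

lemma conjugate_if_doubly_asymptotic: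
  assumes x: "doubly_asymptotic N n p x" and y: "doubly_asymptotic N n q y"
  shows "conjugate (generated_subshift x) (generated_subshift y)"
proof -
  let ?X = "generated_subshift x" and ?Y = "generated_subshift y"
  let ?R = "orbit_pairs x y \<union> orbit_pairs p q"
  have fst: "u \<in> ?X \<longleftrightarrow> (\<exists>v. (u, v) \<in> ?R)" and snd: "v \<in> ?Y \<longleftrightarrow> (\<exists>u. (u, v) \<in> ?R)" for u v
    unfolding generated_subshift_eq_orbits[OF x] generated_subshift_eq_orbits[OF y]
    by (auto simp: orbit_pairs_def)
  have swap: "(v, u) \<in> orbit_pairs y x \<union> orbit_pairs q p" if "(u, v) \<in> ?R" for u v
    using that by (auto simp: orbit_pairs_def)
  have right_unique: "v = v'" if "(u, v) \<in> ?R" "(u, v') \<in> ?R" for u v v'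
    using orbit_pairs_single_valued[OF x y that] .
  have left_unique: "u = u'" if "(u, v) \<in> ?R" "(u', v) \<in> ?R" for u u' v
    using orbit_pairs_single_valued[OF y x swap[OF that(1)] swap[OF that(2)]] .
  define \<phi> where "\<phi> u = (THE v. (u, v) \<in> ?R)" for u
  have \<phi>_eq: "\<phi> u = v" if "(u, v) \<in> ?R" for u v
    unfolding \<phi>_def using that right_unique by blast
  have \<phi>: "(u, \<phi> u) \<in> ?R" if "u \<in> ?X" for u
    using that \<phi>_eq unfolding fst by blast
  obtain m where m: "\<And>u v u' v'. (u, v) \<in> ?R \<Longrightarrow> (u', v') \<in> ?R \<Longrightarrow>
      \<forall>j. \<bar>j\<bar> \<le> int m \<longrightarrow> u j = u' j \<Longrightarrow> v 0 = v' 0"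
    using orbit_pairs_window[OF x y] by blast
  have "sliding_block_code_on ?X \<phi>"
  proof (rule sliding_block_code_onI)
    fix u v i j
    assume u: "u \<in> ?X" and v: "v \<in> ?X"
      and "word u (i - int m) (i + int m) = word v (j - int m) (j + int m)"
    then have eq: "\<forall>d. \<bar>d\<bar> \<le> int m \<longrightarrow> shift_power i u d = shift_power j v d"
      unfolding word_eq_iff by (simp add: add.commute abs_le_iff)
    have "shift_power i (\<phi> u) 0 = shift_power j (\<phi> v) 0"
      using \<phi>[OF u] \<phi>[OF v] orbit_pairs_shift_power by (intro m[OF _ _ eq]) blast+
    then show "\<phi> u i = \<phi> v j"
      by simp
  qed
  moreover have "bij_betw \<phi> ?X ?Y"
    unfolding bij_betw_def
  proof
    show "inj_on \<phi> ?X"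
      by (rule inj_onI) (metis \<phi> left_unique)
    show "\<phi> ` ?X = ?Y"
      using \<phi> \<phi>_eq fst snd by (auto simp: image_iff) metis+
  qed
  ultimately show ?thesis
    unfolding conjugate_def by blast
qed

section \<open>Invariance under conjugacy and the classification\<close>

text \<open>The image of \<open>x\<close> is not periodic, so it lies in the orbit of
  \<open>y\<close> rather than that of \<open>q\<close>. It thus carries the invariants of both
  \<open>x\<close> and \<open>y\<close>, and uniqueness compares them.\<close>

lemma conjugate_imp_invariants_eq:
  assumes x: "doubly_asymptotic N n p x" and y: "doubly_asymptotic N' n' q y"
    and "conjugate (generated_subshift x) (generated_subshift y)"
  shows "N = N' \<and> [n = n'] (mod int N)"
proof -
  let ?X = "generated_subshift x" and ?Y = "generated_subshift y"
  obtain \<phi> where code: "sliding_block_code_on ?X \<phi>" and bij: "bij_betw \<phi> ?X ?Y"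
    using assms(3) by (auto simp: conjugate_def)
  have orbits: "shift_power k x \<in> ?X" "shift_power k p \<in> ?X" for k
    unfolding generated_subshift_eq_orbits[OF x] by blast+
  have \<phi>: "doubly_asymptotic N n (\<phi> p) (\<phi> x)"
    using doubly_asymptotic_image[OF x code bij_betw_imp_inj_on[OF bij] orbits] .
  have "\<phi> x \<in> ?Y"
    using bij orbits(1)[of 0] by (auto dest: bij_betwE)
  moreover have "\<phi> x \<noteq> shift_power k q" for k
  proof
    assume "\<phi> x = shift_power k q"
    moreover have "shift_power (int N') q = q"
      using y by (simp add: doubly_asymptotic_def)
    ultimately have "shift_power (int N') (\<phi> x) = \<phi> x"
      by (metis add.commute shift_power_shift_power)
    then show False
      using \<phi> y by (auto simp: doubly_asymptotic_def)
  qed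
  ultimately obtain k where "\<phi> x = shift_power k y"
    unfolding generated_subshift_eq_orbits[OF y] by blast
  then show ?thesis
    using doubly_asymptotic_unique[OF \<phi>] doubly_asymptotic_shift_power[OF y] by metis
qed

text \<open>Since \<open>p\<close> has period \<open>N\<close>, congruent delays give the same right
  tail; two congruent anomaly sizes can thus be replaced by a single delay.\<close>

lemma doubly_asymptotic_cong:
  assumes "doubly_asymptotic N n p x" and "[n = n'] (mod int N)"
  shows "doubly_asymptotic N n' p x"
proof -
  have "int N dvd n - n'"
    using assms(2) by (simp add: cong_iff_dvd_diff)
  then have "shift_power (n - n') p = p"
    using assms(1) by (simp add: doubly_asymptotic_def)
  then have "p (j - n) = p (j - n')" for j
    using shift_power_fixed_apply[of "n - n'" p "j - n"] by simp
  then show ?thesis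
    using assms(1) by (simp add: doubly_asymptotic_def)
qed

theorem theorem2p3:
  fixes x y :: "int \<Rightarrow> 'a::finite"
  assumes "eventually_periodic x" and "eventually_periodic y"
  shows "conjugate (generated_subshift x) (generated_subshift y) \<longleftrightarrow>
    (\<exists>N. eventual_least_period x = N \<and> eventual_least_period y = N \<and>
         [anomaly_size x = anomaly_size y] (mod N))"
proof -
  obtain p where x: "doubly_asymptotic (eventual_least_period x) (int (anomaly_size x)) p x"
    by (rule eventually_periodic_doubly_asymptotic[OF assms(1)])
  obtain q where y: "doubly_asymptotic (eventual_least_period y) (int (anomaly_size y)) q y"
    by (rule eventually_periodic_doubly_asymptotic[OF assms(2)])
  show ?thesis
  proof
    assume "conjugate (generated_subshift x) (generated_subshift y)"
    then show "\<exists>N. eventual_least_period x = N \<and> eventual_least_period y = N \<and>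
        [anomaly_size x = anomaly_size y] (mod N)"
      using conjugate_imp_invariants_eq[OF x y] by (metis cong_int_iff)
  next
    assume "\<exists>N. eventual_least_period x = N \<and> eventual_least_period y = N \<and>
        [anomaly_size x = anomaly_size y] (mod N)"
    then have eq: "eventual_least_period y = eventual_least_period x"
      and "[int (anomaly_size x) = int (anomaly_size y)] (mod int (eventual_least_period x))"
      by (auto simp: cong_int_iff)
    then have "doubly_asymptotic (eventual_least_period y) (int (anomaly_size y)) p x"
      using doubly_asymptotic_cong[OF x] by simp
    then show "conjugate (generated_subshift x) (generated_subshift y)"
      using y by (rule conjugate_if_doubly_asymptotic)
  qed
qed

end
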